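(* Let $n\in\mathbb{N}$ be such that a finite field $\mathbb{F}$ of size $n$ exists, let $\mathcal{F}$ be the set of all functions $[n]\to[n]$, let $\mathsf{Inv}=(\mathsf{Pre},\mathsf{Qry},\mathsf{Dec})$ be an $s$-advice, $q$-query non-adaptive inverter with $q\le n/16$ and with a $d$-depth affine decision tree decoder, and let $\tau\in[0,1]$. Then for every $\delta\in[0,1]$ and every integer $m\le\frac{n\log(n/q)}{4(d+1)\log n}$, $$\Pr_{f\leftarrow\mathcal{F}}\Big[\Pr_{x\leftarrow[n],\,y=f(x)}\big[\mathsf{Inv}(y;f)\in f^{-1}(y)\big]\ge\tau\Big]\le\alpha_{\tau,\delta}+2^s\cdot\delta^{-m}\prod_{j=1}^{m}\left(\frac{(d+1)j}{n}+\max\Big\{\sqrt[4]{q/n},\ \frac{2(d+1)j\log n}{n\log(n/q)}\Big\}\right),$$ where $\alpha_{\tau,\delta}:=\Pr_{f\leftarrow\mathcal{F}}\big[\exists\,\mathcal{X}\subseteq[n]\text{ with }|\mathcal{X}|\ge\tau n\text{ and }|f(\mathcal{X})|\le\delta n\big]$.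
   Context: Logarithms base 2; $[n]=\{1,\dots,n\}$; $f(\mathcal{X})=\{f(x):x\in\mathcal{X}\}$; $f^{-1}(y)=\{x:f(x)=y\}$. The elements of $\mathbb{F}$ are identified with $[n]$ via a fixed bijection and $f\in\mathcal{F}$ with $(f(1),\dots,f(n))\in\mathbb{F}^n$; $\langle u,w\rangle=\sum_iu_iw_i$ over $\mathbb{F}$. An $s$-advice, $q$-query non-adaptive inverter is a triple of deterministic functions $\mathsf{Pre}:\mathcal{F}\to\{0,1\}^s$, $\mathsf{Qry}:[n]\times\{0,1\}^s\to[n]^q$, $\mathsf{Dec}:[n]\times\{0,1\}^s\times[n]^q\to[n]$, with $\mathsf{Inv}(y;f):=\mathsf{Dec}(y,a,f(\mathsf{Qry}(y,a)))$ for $a=\mathsf{Pre}(f)$. An $n$-input affine decision tree over $\mathbb{F}$ of depth $d$ is a rooted tree in which every internal node $v$ carries a label $\alpha_v\in\mathbb{F}^n$ and has $|\mathbb{F}|$ children, with outgoing edges labeled by the distinct elements of $\mathbb{F}$, every leaf $\ell$ carries a label $o_\ell\in\mathbb{F}$, and every root-to-leaf path has $d$ internal nodes; on input $w\in\mathbb{F}^n$, starting at the root, from internal node $v$ one moves along the edge labeled $\langle\alpha_v,w\rangle$, and the output $\mathcal{T}(w)$ is the label of the leaf reached. The inverter has a $d$-depth affine decision tree decoder if for every $y\in[n]$, $a\in\{0,1\}^s$ and $v=\mathsf{Qry}(y,a)$ there is an $n$-input depth-$d$ affine decision tree $\mathcal{T}^{y,a}$ with $\mathsf{Dec}(y,a,f(v))=\mathcal{T}^{y,a}(f)$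 for every $f\in\mathcal{F}$. *)

theory Defs
  imports "HOL-Probability.Probability"
begin

abbreviation idx :: "nat \<Rightarrow> nat set" where
  "idx n \<equiv> {1..n}"

definition funcs :: "nat \<Rightarrow> (nat \<Rightarrow> nat) set" where
  "funcs n = idx n \<rightarrow>\<^sub>E idx n"

definition bitstrings :: "nat \<Rightarrow> bool list set" where
  "bitstrings s = {a. length a = s}"

definition tuples :: "nat \<Rightarrow> nat \<Rightarrow> nat list set" where
  "tuples n q = {v. length v = q \<and> set v \<subseteq> idx n}"

definition fiber :: "nat \<Rightarrow> (nat \<Rightarrow> nat) \<Rightarrow> nat \<Rightarrow> nat set" where
  "fiber n f y = {x \<in> idx n. f x = y}"

subsection \<open>Non-adaptive inverters\<close>

type_synonym pre = "(nat \<Rightarrow> nat) \<Rightarrow> bool list"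
type_synonym qry = "nat \<Rightarrow> bool list \<Rightarrow> nat list"
type_synonym dec = "nat \<Rightarrow> bool list \<Rightarrow> nat list \<Rightarrow> nat"

definition nonadaptive_inverter ::
  "nat \<Rightarrow> nat \<Rightarrow> nat \<Rightarrow> pre \<Rightarrow> qry \<Rightarrow> dec \<Rightarrow> bool" where
  "nonadaptive_inverter n s q Pre Qry Dec \<longleftrightarrow>
     (\<forall>f \<in> funcs n. Pre f \<in> bitstrings s) \<and>
     (\<forall>y \<in> idx n. \<forall>a \<in> bitstrings s. Qry y a \<in> tuples n q) \<and>
     (\<forall>y \<in> idx n. \<forall>a \<in> bitstrings s. \<forall>w \<in> tuples n q. Dec y a w \<in> idx n)"

definition Inv :: "pre \<Rightarrow> qry \<Rightarrow> dec \<Rightarrow> nat \<Rightarrow> (nat \<Rightarrow> nat) \<Rightarrow> nat" where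
  "Inv Pre Qry Dec y f = (let a = Pre f in Dec y a (map f (Qry y a)))"

subsection \<open>Affine decision trees\<close>

text \<open>
  A vector over the field with coordinates in \<open>{1..n}\<close> is a function on \<open>nat\<close> of
  which only the values at \<open>1, \<dots>, n\<close> are ever used.  The subtree below the outgoing edge
  labeled \<open>b\<close> of \<open>Node \<alpha> c\<close> is \<open>c b\<close>.
\<close>

definition inner_prod :: "nat \<Rightarrow> (nat \<Rightarrow> 'f) \<Rightarrow> (nat \<Rightarrow> 'f) \<Rightarrow> 'f::field" where
  "inner_prod n u w = (\<Sum>i\<in>idx n. u i * w i)"

datatype 'f affine_tree = Leaf 'f | Node "nat \<Rightarrow> 'f" "'f \<Rightarrow> 'f affine_tree"

primrec uniform_depth :: "'f affine_tree \<Rightarrow> nat \<Rightarrow> bool" where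
  "uniform_depth (Leaf b) d \<longleftrightarrow> d = 0"
| "uniform_depth (Node \<alpha> c) d \<longleftrightarrow> (\<exists>d'. d = Suc d' \<and> (\<forall>b. uniform_depth (c b) d'))"

primrec tree_output :: "nat \<Rightarrow> 'f::field affine_tree \<Rightarrow> (nat \<Rightarrow> 'f) \<Rightarrow> 'f" where
  "tree_output n (Leaf b) w = b"
| "tree_output n (Node \<alpha> c) w = tree_output n (c (inner_prod n \<alpha> w)) w"

text \<open>
  The bijection \<open>\<iota>\<close> from \<open>{1..n}\<close> to the field identifies the two; thus \<open>f\<close> becomes the
  vector \<open>\<lambda>i. \<iota> (f i)\<close>, and the output of the decoder becomes a field element.
\<close>

definition affine_decoder ::
  "nat \<Rightarrow> nat \<Rightarrow> nat \<Rightarrow> (nat \<Rightarrow> 'f::field) \<Rightarrow> qry \<Rightarrow> dec \<Rightarrow> bool" where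
  "affine_decoder n s d \<iota> Qry Dec \<longleftrightarrow>
     (\<forall>y \<in> idx n. \<forall>a \<in> bitstrings s. \<exists>T. uniform_depth T d \<and>
        (\<forall>f \<in> funcs n. \<iota> (Dec y a (map f (Qry y a))) = tree_output n T (\<lambda>i. \<iota> (f i))))"

subsection \<open>Probabilities\<close>

definition success_prob :: "nat \<Rightarrow> pre \<Rightarrow> qry \<Rightarrow> dec \<Rightarrow> (nat \<Rightarrow> nat) \<Rightarrow> real" where
  "success_prob n Pre Qry Dec f =
     measure_pmf.prob (pmf_of_set (idx n))
       {x. let y = f x in Inv Pre Qry Dec y f \<in> fiber n f y}"

definition alpha :: "nat \<Rightarrow> real \<Rightarrow> real \<Rightarrow> real" where
  "alpha n \<tau> \<delta> =
     measure_pmf.prob (pmf_of_set (funcs n))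
       {f. \<exists>X \<subseteq> idx n. real (card X) \<ge> \<tau> * real n \<and> real (card (f ` X)) \<le> \<delta> * real n}"

text \<open>
  Since \<open>\<delta> = 0\<close> is allowed, the bound is stated in \<^typ>\<open>ereal\<close>, with \<open>\<delta>\<close> to the power \<open>-m\<close>
  written as \<open>inverse (ereal \<delta>) ^ m\<close>: this is \<open>\<infinity>\<close> for \<open>\<delta> = 0\<close> and \<open>m \<ge> 1\<close>, whereas the
  corresponding \<^typ>\<open>real\<close> expression would be \<open>0\<close>.
\<close>

end

theory Submission
  imports Defs
begin

text \<open>
  Outside the event of \<open>alpha\<close>, success on \<open>f\<close> with advice \<open>a\<close> means that more than
  \<open>\<delta> n\<close> values \<open>y\<close> are inverted. By a union bound over \<open>a\<close> and Markov's inequality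
  for the \<open>m\<close>-th moment, it suffices to bound the probability that \<open>m\<close> independent random
  values are all inverted, for \<open>a\<close> fixed. Conditioning on the first \<open>j - 1\<close> successes and
  on the paths taken in the decision trees leaves \<open>f\<close> uniform on an affine set of codimension
  at most \<open>k = (d + 1) (j - 1)\<close>. The \<open>q\<close> queries for the next \<open>y\<close> and this set
  determine at most \<open>k + q\<close> coordinates of \<open>f\<close>, and at any other coordinate \<open>f\<close> is
  still uniform; so the next inversion succeeds with probability at most \<open>(k + q + 1) / n\<close>.
  This is at most \<open>(d + 1) j / n + q / n\<close>, and \<open>q / n\<close> is below its fourth root.
\<close>

section \<open>Affine sets of vectors over a finite field\<close>

text \<open>Closure under lines through two points would be vacuous over the field with two
  elements. The three-point form yields the translates of linear subspaces, and the empty set, over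
  every field.\<close>

definition affine_set :: "('i \<Rightarrow> 'f::field) set \<Rightarrow> bool" where
  "affine_set A \<longleftrightarrow> (\<forall>u\<in>A. \<forall>v\<in>A. \<forall>w\<in>A. \<forall>t. (\<lambda>i. u i + t * (v i - w i)) \<in> A)"

text \<open>Coordinate evaluations and the inner products at tree nodes are both of this kind, so
  queries and tree steps cut an affine set by the same lemma.\<close>

definition affine_functional :: "(('i \<Rightarrow> 'f::field) \<Rightarrow> 'f) \<Rightarrow> bool" where
  "affine_functional \<phi> \<longleftrightarrow>
     (\<forall>u v w t. \<phi> (\<lambda>i. u i + t * (v i - w i)) = \<phi> u + t * (\<phi> v - \<phi> w))"

text \<open>Codimension is expressed by cardinality, so that no dimension theory is needed.\<close>

definition codim_le :: "nat \<Rightarrow> ('i::finite \<Rightarrow> 'f::{field,finite}) set \<Rightarrow> bool" where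
  "codim_le k A \<longleftrightarrow> affine_set A \<and>
     (A \<noteq> {} \<longrightarrow> CARD('f) ^ CARD('i) \<le> CARD('f) ^ k * card A)"

lemma affine_setD:
  "affine_set A \<Longrightarrow> u \<in> A \<Longrightarrow> v \<in> A \<Longrightarrow> w \<in> A \<Longrightarrow> (\<lambda>i. u i + t * (v i - w i)) \<in> A"
  by (simp add: affine_set_def)

lemma affine_functionalD:
  "affine_functional \<phi> \<Longrightarrow> \<phi> (\<lambda>i. u i + t * (v i - w i)) = \<phi> u + t * (\<phi> v - \<phi> w)"
  by (simp add: affine_functional_def)

lemma affine_functional_coord: "affine_functional (\<lambda>u. u x)"
  by (simp add: affine_functional_def)

lemma affine_functional_inner_prod: "affine_functional (\<lambda>w. inner_prod n \<alpha> (\<lambda>i. w (p i)))"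
  by (simp add: affine_functional_def inner_prod_def algebra_simps sum.distrib sum_subtractf
      sum_distrib_left)

lemma affine_set_hyperplane:
  assumes "affine_set A" "affine_functional \<phi>"
  shows "affine_set {u \<in> A. \<phi> u = b}"
  using assms unfolding affine_set_def by (auto simp: affine_functionalD)

lemma affine_set_agree:
  assumes "affine_set A"
  shows "affine_set {u \<in> A. \<forall>x\<in>Q. u x = w0 x}"
  using assms unfolding affine_set_def by auto

text \<open>Translation by a multiple of \<open>v - w\<close> maps \<open>A\<close> into itself and
  shifts \<open>\<phi>\<close> by a constant, so every level set injects into every other; together
  they partition \<open>A\<close>.\<close>

lemma equidistributed:
  fixes A :: "('i::finite \<Rightarrow> 'f::{field,finite}) set"
  assumes A: "affine_set A" and \<phi>: "affine_functional \<phi>"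
    and vw: "v \<in> A" "w \<in> A" "\<phi> v \<noteq> \<phi> w"
  shows "CARD('f) * card {u \<in> A. \<phi> u = b} = card A"
proof -
  have le: "card {u \<in> A. \<phi> u = b} \<le> card {u \<in> A. \<phi> u = c}" for b c
  proof -
    define t where "t = (c - b) / (\<phi> v - \<phi> w)"
    have t: "b + t * (\<phi> v - \<phi> w) = c" using vw by (simp add: t_def)
    let ?g = "\<lambda>u i. u i + t * (v i - w i)"
    show ?thesis
    proof (rule card_inj_on_le[of ?g])
      show "inj_on ?g {u \<in> A. \<phi> u = b}"
        by (rule inj_onI) (simp add: fun_eq_iff)
      show "?g ` {u \<in> A. \<phi> u = b} \<subseteq> {u \<in> A. \<phi> u = c}"
        using vw t by (auto simp: affine_functionalD[OF \<phi>] intro!: affine_setD[OF A])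
    qed simp
  qed
  have eq: "card {u \<in> A. \<phi> u = c} = card {u \<in> A. \<phi> u = b}" for c
    by (rule le_antisym[OF le le])
  have "card A = card (\<Union>c\<in>UNIV. {u \<in> A. \<phi> u = c})"
    by (rule arg_cong[of _ _ card]) auto
  also have "\<dots> = (\<Sum>c\<in>UNIV. card {u \<in> A. \<phi> u = c})"
    by (rule card_UN_disjoint) auto
  also have "\<dots> = (\<Sum>c\<in>(UNIV :: 'f set). card {u \<in> A. \<phi> u = b})"
    by (rule sum.cong[OF refl eq])
  finally show ?thesis by simp
qed

text \<open>If \<open>\<phi>\<close> is not constant on \<open>A\<close>, its level sets have equal
  size and each loses exactly a factor \<open>CARD('f)\<close>; if it is constant, a nonempty level
  set is all of \<open>A\<close>.\<close>

lemma codim_le_hyperplane: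
  fixes A :: "('i::finite \<Rightarrow> 'f::{field,finite}) set"
  assumes A: "codim_le k A" and \<phi>: "affine_functional \<phi>"
  shows "codim_le (Suc k) {u \<in> A. \<phi> u = b}" (is "codim_le _ ?B")
proof -
  have aff: "affine_set A" using A by (simp add: codim_le_def)
  have "CARD('f) ^ CARD('i) \<le> CARD('f) ^ Suc k * card ?B" if "?B \<noteq> {}"
  proof -
    have "CARD('f) ^ CARD('i) \<le> CARD('f) ^ k * card A"
      using A that by (auto simp: codim_le_def)
    moreover have "card A \<le> CARD('f) * card ?B"
    proof (cases "\<exists>v\<in>A. \<exists>w\<in>A. \<phi> v \<noteq> \<phi> w")
      case True
      then obtain v w where "v \<in> A" "w \<in> A" "\<phi> v \<noteq> \<phi> w" by blast
      from equidistributed[OF aff \<phi> this, of b] show ?thesis by simp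
    next
      case False
      then have "?B = A" using that by blast
      then show ?thesis by simp
    qed
    then have "CARD('f) ^ k * card A \<le> CARD('f) ^ k * (CARD('f) * card ?B)"
      by (rule mult_le_mono2)
    ultimately show ?thesis
      by (simp only: power_Suc2 mult.assoc)
  qed
  then show ?thesis
    using affine_set_hyperplane[OF aff \<phi>] by (simp add: codim_le_def)
qed

lemma codim_le_agree:
  assumes "codim_le k A" "finite Q"
  shows "codim_le (k + card Q) {u \<in> A. \<forall>x\<in>Q. u x = w0 x}"
  using assms(2)
proof induction
  case empty
  then show ?case using assms(1) by simp
next
  case (insert x Q)
  have "{u \<in> A. \<forall>z\<in>insert x Q. u z = w0 z} =
      {u \<in> {u \<in> A. \<forall>z\<in>Q. u z = w0 z}. u x = w0 x}"
    by auto
  then show ?case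
    using codim_le_hyperplane[OF insert.IH affine_functional_coord, of x "w0 x"] insert.hyps
    by simp
qed

text \<open>\<open>A\<close> lies in a box with one choice for each constant coordinate and
  \<open>CARD('f)\<close> for each other one. This bounds \<open>card A\<close> from above, and
  \<open>codim_le\<close> bounds it from below.\<close>

lemma card_constant_coords_le:
  fixes A :: "('i::finite \<Rightarrow> 'f::{field,finite}) set"
  assumes A: "codim_le k A" and w0: "w0 \<in> A"
  shows "card {x. \<forall>u\<in>A. u x = w0 x} \<le> k"
proof -
  let ?D = "{x. \<forall>u\<in>A. u x = w0 x}"
  have n2: "1 < CARD('f)"
    using card_mono[of "UNIV :: 'f set" "{0, 1}"] by simp
  have "card A \<le> card (PiE UNIV (\<lambda>x. if x \<in> ?D then {w0 x} else UNIV))"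
    by (rule card_mono) (auto intro!: finite_PiE)
  also have "\<dots> = (\<Prod>x\<in>UNIV. card (if x \<in> ?D then {w0 x} else (UNIV :: 'f set)))"
    by (rule card_PiE) simp
  also have "\<dots> = (\<Prod>x\<in>UNIV. if x \<in> ?D then 1 else CARD('f))"
    by (intro prod.cong) auto
  also have "\<dots> = CARD('f) ^ card (- ?D)"
    by (subst prod.If_cases) (simp_all add: Compl_eq)
  also have "card (- ?D) = CARD('i) - card ?D"
    by (simp add: Compl_eq_Diff_UNIV card_Diff_subset)
  finally have "CARD('f) ^ k * card A \<le> CARD('f) ^ k * CARD('f) ^ (CARD('i) - card ?D)"
    by (rule mult_le_mono2)
  moreover have "CARD('f) ^ CARD('i) \<le> CARD('f) ^ k * card A"
    using A w0 by (auto simp: codim_le_def)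
  ultimately have "CARD('f) ^ CARD('i) \<le> CARD('f) ^ k * CARD('f) ^ (CARD('i) - card ?D)"
    by linarith
  then have "CARD('i) \<le> k + (CARD('i) - card ?D)"
    using n2 by (simp flip: power_add)
  moreover have "card ?D \<le> CARD('i)" by (rule card_mono) auto
  ultimately show ?thesis by linarith
qed

section \<open>Inverting on an affine set\<close>

text \<open>
  Outside the coordinates determined by the queried ones, the value at the output is uniform
  given the answers to the queries.
\<close>

lemma card_undetermined_hits:
  fixes A :: "('i::finite \<Rightarrow> 'f::{field,finite}) set"
  assumes A: "affine_set A" and w0: "w0 \<in> A"
    and X: "\<And>u v. (\<forall>x\<in>Q. u x = v x) \<Longrightarrow> X u = X v"
  shows "CARD('f) * card {w \<in> A. X w \<notin> {x. \<forall>u\<in>{u \<in> A. \<forall>x\<in>Q. u x = w0 x}. u x = w0 x} \<and> w (X w) = y}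
    \<le> card A"
proof -
  define D where "D = {x. \<forall>u\<in>{u \<in> A. \<forall>x\<in>Q. u x = w0 x}. u x = w0 x}"
  define B where "B r = {w \<in> A. restrict w Q = r}" for r
  let ?R = "(\<lambda>w. restrict w Q) ` A"
  have fib: "CARD('f) * card {w \<in> B r. X w \<notin> D \<and> w (X w) = y} \<le> card (B r)" if r: "r \<in> ?R" for r
  proof -
    obtain v where v: "v \<in> A" "r = restrict v Q" using r by blast
    have agree: "restrict w Q = r \<longleftrightarrow> (\<forall>x\<in>Q. w x = v x)" for w
      using v(2) by (auto simp: restrict_def fun_eq_iff)
    have B: "B r = {u \<in> A. \<forall>x\<in>Q. u x = v x}"
      unfolding B_def agree ..
    have XB: "X w = X v" if "w \<in> B r" for w
      using X[of w v] that unfolding B by blast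
    show ?thesis
    proof (cases "X v \<in> D")
      case True
      then have "X w \<in> D" if "w \<in> B r" for w
        using XB[OF that] by simp
      then have "{w \<in> B r. X w \<notin> D \<and> w (X w) = y} = {}"
        by blast
      then show ?thesis by (simp only: card.empty)
    next
      case False
      then obtain u where u: "u \<in> A" "\<forall>x\<in>Q. u x = w0 x" "u (X v) \<noteq> w0 (X v)"
        unfolding D_def by blast
      \<comment> \<open>\<open>u\<close> and \<open>w0\<close> agree on \<open>Q\<close>, so adding
        \<open>u - w0\<close> keeps the answers of \<open>v\<close> but changes its coordinate
        \<open>X v\<close>. Hence one \<open>D\<close>, read off at \<open>w0\<close>, serves for
        all answers.\<close>
      let ?v' = "\<lambda>i. v i + 1 * (u i - w0 i)"
      have "affine_set (B r)" unfolding B by (rule affine_set_agree[OF A])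
      moreover have "?v' \<in> B r"
        using affine_setD[OF A v(1) u(1) w0, of 1] u(2) unfolding B by simp
      moreover have "v \<in> B r" using v unfolding B by simp
      moreover have "?v' (X v) \<noteq> v (X v)" using u(3) by simp
      ultimately have "CARD('f) * card {w \<in> B r. w (X v) = y} = card (B r)"
        using equidistributed[OF _ affine_functional_coord] by blast
      moreover have "w (X v) = y" if "w \<in> B r" "w (X w) = y" for w
        using XB[OF that(1)] that(2) by simp
      then have "{w \<in> B r. X w \<notin> D \<and> w (X w) = y} \<subseteq> {w \<in> B r. w (X v) = y}"
        by blast
      then have "card {w \<in> B r. X w \<notin> D \<and> w (X w) = y} \<le> card {w \<in> B r. w (X v) = y}"
        by (rule card_mono[rotated]) simp
      then have "CARD('f) * card {w \<in> B r. X w \<notin> D \<and> w (X w) = y}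
          \<le> CARD('f) * card {w \<in> B r. w (X v) = y}"
        by (rule mult_le_mono2)
      ultimately show ?thesis by linarith
    qed
  qed
  have "card {w \<in> A. X w \<notin> D \<and> w (X w) = y} =
      card (\<Union>r\<in>?R. {w \<in> B r. X w \<notin> D \<and> w (X w) = y})"
    by (rule arg_cong[of _ _ card]) (auto simp: B_def)
  also have "\<dots> = (\<Sum>r\<in>?R. card {w \<in> B r. X w \<notin> D \<and> w (X w) = y})"
    by (rule card_UN_disjoint) (auto simp: B_def)
  finally have "CARD('f) * card {w \<in> A. X w \<notin> D \<and> w (X w) = y} \<le> (\<Sum>r\<in>?R. card (B r))"
    using fib by (simp add: sum_distrib_left sum_mono)
  also have "\<dots> = card (\<Union>r\<in>?R. B r)"
    by (rule card_UN_disjoint[symmetric]) (auto simp: B_def)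
  also have "\<dots> \<le> card A"
    by (rule card_mono) (auto simp: B_def)
  finally show ?thesis unfolding D_def .
qed

text \<open>
  At most \<open>k + q\<close> coordinates are determined by \<open>A\<close> and the queries. Those that are constant
  on \<open>A\<close> serve a single \<open>y\<close> each, the others are uniform on \<open>A\<close>.
\<close>

lemma sum_hits_le:
  fixes A :: "('i::finite \<Rightarrow> 'f::{field,finite}) set"
    and X :: "'f \<Rightarrow> ('i \<Rightarrow> 'f) \<Rightarrow> 'i"
  assumes A: "codim_le k A"
    and Q: "\<And>y. card (Q y) \<le> q"
    and X: "\<And>y u v. (\<forall>x\<in>Q y. u x = v x) \<Longrightarrow> X y u = X y v"
  shows "(\<Sum>y\<in>UNIV. card {w \<in> A. w (X y w) = y}) \<le> card A * (k + q + 1)"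
proof (cases "A = {}")
  case True
  then show ?thesis by simp
next
  case False
  then obtain w0 where w0: "w0 \<in> A" by blast
  have aff: "affine_set A" using A by (simp add: codim_le_def)
  let ?n = "CARD('f)"
  define C where "C = {x. \<forall>u\<in>A. u x = w0 x}"
  define D where "D y = {x. \<forall>u\<in>{u \<in> A. \<forall>x\<in>Q y. u x = w0 x}. u x = w0 x}" for y
  have CD: "C \<subseteq> D y" for y unfolding C_def D_def by blast
  have cardD: "card (D y) \<le> k + q" for y
  proof -
    have "card (D y) \<le> k + card (Q y)"
      unfolding D_def
      by (rule card_constant_coords_le[OF codim_le_agree[OF A]]) (use w0 in simp_all)
    then show ?thesis using Q[of y] by linarith
  qed
  \<comment> \<open>Any \<open>y\<close> will do here. The bound makes the natural subtraction
    \<open>k + q - card C\<close> below exact.\<close>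
  have cardC: "card C \<le> k + q" using CD cardD card_mono[of "D undefined" C]
    by (meson finite order_trans)
  \<comment> \<open>The cases are an output outside \<open>D y\<close> (\<open>?U\<close>), in
    \<open>D y\<close> but not in \<open>C\<close> (\<open>?V\<close>), and in \<open>C\<close>
    (\<open>?W\<close>). An output \<open>x\<close> in \<open>C\<close> can hit only if
    \<open>w0 x = y\<close>, and then possibly on all of \<open>A\<close>.\<close>
  have step: "?n * card {w \<in> A. w (X y w) = y}
      \<le> card A * (k + q - card C + 1) + ?n * card A * card {x \<in> C. w0 x = y}" for y
  proof -
    let ?U = "{w \<in> A. X y w \<notin> D y \<and> w (X y w) = y}"
    let ?V = "\<Union>x\<in>D y - C. {w \<in> A. w x = y}"
    let ?W = "\<Union>x\<in>{x \<in> C. w0 x = y}. A"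
    have "{w \<in> A. w (X y w) = y} \<subseteq> ?U \<union> (?V \<union> ?W)"
    proof
      fix w assume w: "w \<in> {w \<in> A. w (X y w) = y}"
      moreover have "w x = w0 x" if "x \<in> C" for x
        using that w by (auto simp: C_def)
      ultimately show "w \<in> ?U \<union> (?V \<union> ?W)" by fastforce
    qed
    then have "card {w \<in> A. w (X y w) = y} \<le> card (?U \<union> (?V \<union> ?W))"
      by (rule card_mono[rotated]) simp
    also have "\<dots> \<le> card ?U + (card ?V + card ?W)"
      by (meson add_left_mono card_Un_le order_trans)
    finally have "?n * card {w \<in> A. w (X y w) = y} \<le> ?n * (card ?U + (card ?V + card ?W))"
      by (rule mult_le_mono2)
    then have "?n * card {w \<in> A. w (X y w) = y} \<le> ?n * card ?U + ?n * card ?V + ?n * card ?W"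
      by (simp only: distrib_left add.assoc)
    moreover have "?n * card ?U \<le> card A"
      unfolding D_def by (rule card_undetermined_hits[OF aff w0 X])
    moreover have "?n * card ?V \<le> card A * (k + q - card C)"
    proof -
      have "?n * card ?V \<le> ?n * (\<Sum>x\<in>D y - C. card {w \<in> A. w x = y})"
        by (intro mult_le_mono2 card_UN_le) simp
      also have "\<dots> = (\<Sum>x\<in>D y - C. card A)"
        unfolding sum_distrib_left
      proof (rule sum.cong[OF refl])
        fix x assume "x \<in> D y - C"
        then obtain u where "u \<in> A" "u x \<noteq> w0 x" unfolding C_def by blast
        then show "?n * card {w \<in> A. w x = y} = card A"
          using equidistributed[OF aff affine_functional_coord, of u w0 x] w0 by simp
      qed
      also have "\<dots> = card A * (card (D y) - card C)"
        using CD by (simp add: card_Diff_subset)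
      also have "\<dots> \<le> card A * (k + q - card C)"
        using cardD by (intro mult_le_mono2 diff_le_mono)
      finally show ?thesis .
    qed
    moreover have "card ?W \<le> card {x \<in> C. w0 x = y} * card A"
      using card_UN_le[of "{x \<in> C. w0 x = y}" "\<lambda>_. A"] by simp
    then have "?n * card ?W \<le> ?n * (card {x \<in> C. w0 x = y} * card A)"
      by (rule mult_le_mono2)
    then have "?n * card ?W \<le> ?n * card A * card {x \<in> C. w0 x = y}"
      by (simp only: mult.assoc mult.commute[of "card A"])
    ultimately show ?thesis unfolding distrib_left mult_1_right by linarith
  qed
  \<comment> \<open>\<open>w0\<close> sends each coordinate in \<open>C\<close> to exactly one
    \<open>y\<close>, so over all \<open>y\<close> the last summands of \<open>step\<close> restore
    the \<open>card C\<close> subtracted in the first.\<close>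
  have "(\<Sum>y\<in>UNIV. card {x \<in> C. w0 x = y}) = card (\<Union>y\<in>UNIV. {x \<in> C. w0 x = y})"
    by (rule card_UN_disjoint[symmetric]) auto
  also have "(\<Union>y\<in>UNIV. {x \<in> C. w0 x = y}) = C" by auto
  finally have sumC: "(\<Sum>y\<in>UNIV. card {x \<in> C. w0 x = y}) = card C" .
  have "?n * (\<Sum>y\<in>UNIV. card {w \<in> A. w (X y w) = y})
      \<le> (\<Sum>y\<in>UNIV. card A * (k + q - card C + 1) + ?n * card A * card {x \<in> C. w0 x = y})"
    unfolding sum_distrib_left by (rule sum_mono[OF step])
  also have "\<dots> = ?n * (card A * (k + q - card C + 1)) + ?n * card A * card C"
    by (simp add: sum.distrib sumC flip: sum_distrib_left)
  also have "\<dots> = ?n * (card A * ((k + q - card C) + card C + 1))"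
    by (simp add: algebra_simps)
  also have "\<dots> = ?n * (card A * (k + q + 1))"
    using cardC by simp
  finally show ?thesis by simp
qed

section \<open>Moments of the number of hits along decision trees\<close>

text \<open>The paths of \<open>T\<close> split the hit event into affine pieces: \<open>d\<close>
  equations from the nodes, and one from the leaf, where the coordinate output must have value
  \<open>y\<close>. The assumed bound for \<open>g\<close> applies to each piece.\<close>

lemma sum_over_tree_le:
  fixes T :: "'f::{field,finite} affine_tree" and g :: "('f \<Rightarrow> 'f) \<Rightarrow> nat"
  assumes "uniform_depth T d" "codim_le k A"
    and "\<And>A'. codim_le (k + d + 1) A' \<Longrightarrow> (\<Sum>w\<in>A'. g w) \<le> card A' * b"
  shows "(\<Sum>w | w \<in> A \<and> w (tree_output n T (\<lambda>i. w (p i))) = y. g w)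
    \<le> card {w \<in> A. w (tree_output n T (\<lambda>i. w (p i))) = y} * b"
  using assms
proof (induction T arbitrary: d k A)
  case (Leaf x)
  then have "codim_le (k + d + 1) {w \<in> A. w x = y}"
    using codim_le_hyperplane[OF Leaf.prems(2) affine_functional_coord, of x y] by simp
  then show ?case using Leaf.prems(3) by simp
next
  case (Node \<alpha> c)
  obtain d' where d': "d = Suc d'" "\<And>z. uniform_depth (c z) d'"
    using Node.prems(1) by auto
  let ?\<phi> = "\<lambda>w. inner_prod n \<alpha> (\<lambda>i. w (p i))"
  let ?H = "{w \<in> A. w (tree_output n (Node \<alpha> c) (\<lambda>i. w (p i))) = y}"
  let ?H' = "\<lambda>z. {w \<in> {w \<in> A. ?\<phi> w = z}. w (tree_output n (c z) (\<lambda>i. w (p i))) = y}"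
  have H: "?H = (\<Union>z\<in>UNIV. ?H' z)" by auto
  have "(\<Sum>w\<in>?H. g w) = (\<Sum>z\<in>UNIV. \<Sum>w\<in>?H' z. g w)"
    unfolding H by (rule sum.UNION_disjoint) auto
  also have "\<dots> \<le> (\<Sum>z\<in>UNIV. card (?H' z) * b)"
  proof (rule sum_mono)
    fix z
    show "(\<Sum>w\<in>?H' z. g w) \<le> card (?H' z) * b"
      by (rule Node.IH[OF _ d'(2) codim_le_hyperplane[OF Node.prems(2) affine_functional_inner_prod]])
        (use Node.prems(3) d'(1) in auto)
  qed
  also have "\<dots> = card ?H * b"
    unfolding H by (subst card_UN_disjoint) (auto simp: sum_distrib_right)
  finally show ?case .
qed

text \<open>The power counts \<open>m\<close>-tuples of hits, repetitions allowed. Fixing the first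
  hit \<open>y\<close> leaves one power less, summed over the event that \<open>y\<close> is hit;
  its pieces have codimension at most \<open>k + d + 1\<close>, so the induction must run over all
  \<open>k\<close> and \<open>A\<close>.\<close>

lemma sum_hits_power_le:
  fixes T :: "'f::{field,finite} \<Rightarrow> 'f affine_tree" and p :: "nat \<Rightarrow> 'f" and n :: nat
  defines "X \<equiv> \<lambda>y w. tree_output n (T y) (\<lambda>i. w (p i))"
  assumes T: "\<And>y. uniform_depth (T y) d"
    and Q: "\<And>y. card (Q y) \<le> q"
    and X: "\<And>y u v. (\<forall>x\<in>Q y. u x = v x) \<Longrightarrow> X y u = X y v"
    and A: "codim_le k A"
  shows "(\<Sum>w\<in>A. card {y. w (X y w) = y} ^ m) \<le> card A * (\<Prod>j=1..m. k + (d + 1) * (j - 1) + q + 1)"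
  using A
proof (induction m arbitrary: k A)
  case 0
  then show ?case by simp
next
  case (Suc m)
  let ?N = "\<lambda>w. card {y. w (X y w) = y}"
  let ?b = "\<Prod>j=1..m. k + d + 1 + (d + 1) * (j - 1) + q + 1"
  have IH: "(\<Sum>w\<in>A'. ?N w ^ m) \<le> card A' * ?b" if "codim_le (k + d + 1) A'" for A'
    using Suc.IH[OF that] .
  have "(\<Sum>w\<in>A. ?N w ^ Suc m) = (\<Sum>w\<in>A. \<Sum>y\<in>UNIV. if w (X y w) = y then ?N w ^ m else 0)"
    by (simp add: sum.If_cases)
  also have "\<dots> = (\<Sum>y\<in>UNIV. \<Sum>w\<in>A. if w (X y w) = y then ?N w ^ m else 0)"
    by (rule sum.swap)
  also have "\<dots> = (\<Sum>y\<in>UNIV. \<Sum>w | w \<in> A \<and> w (X y w) = y. ?N w ^ m)"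
    by (simp add: sum.If_cases Int_def)
  also have "\<dots> \<le> (\<Sum>y\<in>UNIV. card {w \<in> A. w (X y w) = y} * ?b)"
    unfolding X_def
    by (intro sum_mono sum_over_tree_le[OF T Suc.prems]) (rule IH[unfolded X_def])
  also have "\<dots> \<le> card A * (k + q + 1) * ?b"
    unfolding sum_distrib_right[symmetric]
    by (intro mult_le_mono1 sum_hits_le[OF Suc.prems Q X])
  \<comment> \<open>Raising \<open>k\<close> by \<open>d + 1\<close> shifts the index by one; the
    factor \<open>k + q + 1\<close> is the missing one at \<open>j = 1\<close>.\<close>
  also have "?b = (\<Prod>j=2..Suc m. k + (d + 1) * (j - 1) + q + 1)"
  proof -
    have "k + d + 1 + (d + 1) * (j - 1) + q + 1 = k + (d + 1) * (Suc j - 1) + q + 1"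
      if "j \<in> {1..m}" for j
      using that by (cases j) simp_all
    then have "?b = (\<Prod>j=1..m. k + (d + 1) * (Suc j - 1) + q + 1)"
      by (intro prod.cong) auto
    also have "\<dots> = (\<Prod>j=Suc 1..Suc m. k + (d + 1) * (j - 1) + q + 1)"
      by (rule prod.shift_bounds_cl_Suc_ivl[symmetric])
    finally show ?thesis by (simp only: numeral_2_eq_2 One_nat_def)
  qed
  also have "card A * (k + q + 1) * \<dots> = card A * (\<Prod>j=1..Suc m. k + (d + 1) * (j - 1) + q + 1)"
    by (subst prod.atLeast_Suc_atMost[of 1 "Suc m"])
      (simp_all only: numeral_2_eq_2 One_nat_def diff_self_eq_0 mult_0_right add_0_right mult.assoc le_add1 Suc_le_mono zero_le)
  finally show ?case .
qed

section \<open>Transfer to inverters\<close>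

lemma tree_output_cong:
  "(\<And>i. i \<in> idx n \<Longrightarrow> u i = v i) \<Longrightarrow> tree_output n T u = tree_output n T v"
proof (induction T)
  case (Node \<alpha> c)
  have "inner_prod n \<alpha> u = inner_prod n \<alpha> v"
    using Node.prems by (simp add: inner_prod_def)
  then show ?case using Node by simp
qed simp

text \<open>The advice is a parameter in place of \<open>Pre f\<close>: with \<open>a\<close> fixed,
  queries and trees depend on \<open>y\<close> alone, and the union bound can run over
  \<open>a\<close>.\<close>

definition inverted :: "nat \<Rightarrow> qry \<Rightarrow> dec \<Rightarrow> bool list \<Rightarrow> (nat \<Rightarrow> nat) \<Rightarrow> nat set" where
  "inverted n Qry Dec a f = {y \<in> idx n. f (Dec y a (map f (Qry y a))) = y}"

text \<open>Functions become vectors in \<open>'f \<Rightarrow> 'f\<close>, with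
  \<open>\<iota>\<close> renaming arguments and values alike, so that a tree output can itself serve
  as a coordinate. The moment bound is then applied to the full space, of codimension
  \<open>0\<close>.\<close>

lemma sum_inverted_power_le:
  fixes \<iota> :: "nat \<Rightarrow> 'f::{field,finite}"
  assumes n: "CARD('f) = n" and \<iota>: "bij_betw \<iota> (idx n) (UNIV :: 'f set)"
    and inv: "nonadaptive_inverter n s q Pre Qry Dec"
    and dec: "affine_decoder n s d \<iota> Qry Dec"
    and a: "a \<in> bitstrings s"
  shows "(\<Sum>f\<in>funcs n. card (inverted n Qry Dec a f) ^ m) \<le> n ^ n * (\<Prod>j=1..m. (d + 1) * j + q)"
proof -
  define \<kappa> where "\<kappa> = the_inv_into (idx n) \<iota>"
  have inj: "inj_on \<iota> (idx n)" and img: "\<iota> ` idx n = UNIV"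
    using \<iota> by (auto simp: bij_betw_def)
  have \<kappa>\<iota>: "\<kappa> (\<iota> i) = i" if "i \<in> idx n" for i
    unfolding \<kappa>_def by (rule the_inv_into_f_f[OF inj that])
  have \<iota>\<kappa>: "\<iota> (\<kappa> z) = z" for z
    unfolding \<kappa>_def using f_the_inv_into_f[OF inj] img by blast
  have \<kappa>: "\<kappa> z \<in> idx n" for z
    unfolding \<kappa>_def using the_inv_into_into[OF inj, of z "idx n"] img by blast
  define \<Theta> where "\<Theta> f z = \<iota> (f (\<kappa> z))" for f z
  define \<Psi> where "\<Psi> w = restrict (\<lambda>i. \<kappa> (w (\<iota> i))) (idx n)" for w
  have \<Theta>\<iota>: "\<Theta> f (\<iota> i) = \<iota> (f i)" if "i \<in> idx n" for f i
    using that by (simp add: \<Theta>_def \<kappa>\<iota>)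
  have \<Psi>: "\<Psi> w \<in> funcs n" for w
    using \<kappa> by (auto simp: \<Psi>_def funcs_def)
  have \<Theta>\<Psi>: "\<Theta> (\<Psi> w) = w" for w
    by (rule ext) (use \<kappa> in \<open>simp add: \<Theta>_def \<Psi>_def \<iota>\<kappa>\<close>)
  have \<Psi>\<Theta>: "\<Psi> (\<Theta> f) = f" if "f \<in> funcs n" for f
  proof
    fix i
    show "\<Psi> (\<Theta> f) i = f i"
    proof (cases "i \<in> idx n")
      case True
      moreover from this that have "f i \<in> idx n" unfolding funcs_def by (rule PiE_mem[rotated])
      ultimately show ?thesis by (simp add: \<Psi>_def \<Theta>\<iota> \<kappa>\<iota>)
    next
      case False
      then show ?thesis using that by (auto simp: \<Psi>_def funcs_def PiE_def extensional_def)
    qed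
  qed
  have "\<forall>z. \<exists>T. uniform_depth T d \<and> (\<forall>f \<in> funcs n.
      \<iota> (Dec (\<kappa> z) a (map f (Qry (\<kappa> z) a))) = tree_output n T (\<lambda>i. \<iota> (f i)))"
    using dec a \<kappa> unfolding affine_decoder_def by blast
  then obtain T where T: "\<And>z. uniform_depth (T z) d"
    and out: "\<And>z f. f \<in> funcs n \<Longrightarrow>
      \<iota> (Dec (\<kappa> z) a (map f (Qry (\<kappa> z) a))) = tree_output n (T z) (\<lambda>i. \<iota> (f i))"
    by metis
  define X where "X z w = tree_output n (T z) (\<lambda>i. w (\<iota> i))" for z w
  have X\<Theta>: "X z (\<Theta> f) = \<iota> (Dec (\<kappa> z) a (map f (Qry (\<kappa> z) a)))" if "f \<in> funcs n" for z f
    unfolding X_def out[OF that] by (rule tree_output_cong) (simp add: \<Theta>\<iota>)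
  define Q where "Q z = \<iota> ` set (Qry (\<kappa> z) a)" for z
  have qry: "length (Qry y a) = q" "set (Qry y a) \<subseteq> idx n" if "y \<in> idx n" for y
    using inv a that by (auto simp: nonadaptive_inverter_def tuples_def)
  have dec_mem: "Dec y a (map f (Qry y a)) \<in> idx n" if "y \<in> idx n" "f \<in> funcs n" for y f
  proof -
    have "f ` idx n \<subseteq> idx n" using that(2) by (auto simp: funcs_def)
    then have "map f (Qry y a) \<in> tuples n q"
      using qry[OF that(1)] by (auto simp: tuples_def)
    then show ?thesis using inv a that(1) by (auto simp: nonadaptive_inverter_def)
  qed
  have cardQ: "card (Q z) \<le> q" for z
    unfolding Q_def using qry(1)[OF \<kappa>] by (metis card_image_le card_length finite_set order_trans)
  \<comment> \<open>The labels of a tree may involve all coordinates. Locality comes from its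
    agreement with \<open>Dec\<close> on every function, carried over by
    \<open>\<Psi>\<close>.\<close>
  have localX: "X z u = X z v" if "\<forall>x\<in>Q z. u x = v x" for z u v
  proof -
    have "map (\<Psi> u) (Qry (\<kappa> z) a) = map (\<Psi> v) (Qry (\<kappa> z) a)"
      using that qry(2)[OF \<kappa>, of z] by (auto simp: \<Psi>_def Q_def)
    then show ?thesis using X\<Theta>[OF \<Psi>, of z u] X\<Theta>[OF \<Psi>, of z v] by (simp only: \<Theta>\<Psi>)
  qed
  have card_inverted: "card (inverted n Qry Dec a f) = card {z. \<Theta> f (X z (\<Theta> f)) = z}"
    if f: "f \<in> funcs n" for f
  proof (rule bij_betw_same_card[of \<iota>])
    have hit: "\<Theta> f (X (\<iota> y) (\<Theta> f)) = \<iota> y \<longleftrightarrow> f (Dec y a (map f (Qry y a))) = y"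
      if y: "y \<in> idx n" for y
    proof -
      let ?x = "Dec y a (map f (Qry y a))"
      have x: "?x \<in> idx n" by (rule dec_mem[OF y f])
      moreover have "f ?x \<in> idx n" using f x unfolding funcs_def by (rule PiE_mem)
      ultimately show ?thesis
        using inj y by (simp add: X\<Theta>[OF f] \<kappa>\<iota> \<Theta>\<iota> inj_on_eq_iff)
    qed
    have "\<iota> ` inverted n Qry Dec a f = {z. \<Theta> f (X z (\<Theta> f)) = z}"
    proof (intro equalityI subsetI)
      fix z assume "z \<in> {z. \<Theta> f (X z (\<Theta> f)) = z}"
      then have "\<kappa> z \<in> inverted n Qry Dec a f"
        using hit[OF \<kappa>, of z] \<kappa>[of z] by (simp add: \<iota>\<kappa> inverted_def)
      then show "z \<in> \<iota> ` inverted n Qry Dec a f" using \<iota>\<kappa>[of z] by (metis imageI)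
    qed (auto simp: inverted_def hit)
    moreover have "inj_on \<iota> (inverted n Qry Dec a f)"
      using inj by (rule inj_on_subset) (auto simp: inverted_def)
    ultimately show "bij_betw \<iota> (inverted n Qry Dec a f) {z. \<Theta> f (X z (\<Theta> f)) = z}"
      by (simp add: bij_betw_def)
  qed
  have "(\<Sum>f\<in>funcs n. card (inverted n Qry Dec a f) ^ m) = (\<Sum>w\<in>UNIV. card {z. w (X z w) = z} ^ m)"
    by (rule sum.reindex_bij_witness[of _ \<Psi> \<Theta>]) (auto simp: \<Theta>\<Psi> \<Psi>\<Theta> \<Psi> card_inverted)
  also have "\<dots> \<le> card (UNIV :: ('f \<Rightarrow> 'f) set) * (\<Prod>j=1..m. 0 + (d + 1) * (j - 1) + q + 1)"
    unfolding X_def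
  proof (rule sum_hits_power_le[OF T cardQ])
    show "codim_le 0 (UNIV :: ('f \<Rightarrow> 'f) set)"
      by (simp add: codim_le_def affine_set_def card_fun)
  qed (use localX in \<open>auto simp: X_def\<close>)
  also have "\<dots> \<le> n ^ n * (\<Prod>j=1..m. (d + 1) * j + q)"
  proof -
    \<comment> \<open>The two sides differ by \<open>d\<close>. The range \<open>j \<ge> 1\<close>
      matters: at \<open>j = 0\<close> truncated subtraction would break the inequality.\<close>
    have "0 + (d + 1) * (j - 1) + q + 1 \<le> (d + 1) * j + q" if "j \<in> {1..m}" for j
      using that by (cases j) simp_all
    then have "(\<Prod>j=1..m. 0 + (d + 1) * (j - 1) + q + 1) \<le> (\<Prod>j=1..m. (d + 1) * j + q)"
      by (intro prod_mono) auto
    moreover have "card (UNIV :: ('f \<Rightarrow> 'f) set) = n ^ n"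
      by (simp add: card_fun flip: n)
    ultimately show ?thesis by (simp only: mult_le_mono2)
  qed
  finally show ?thesis .
qed

section \<open>Markov's inequality and the union bound over advice strings\<close>

text \<open>Each counted \<open>f\<close> contributes at least \<open>(\<delta> * n) ^ m\<close> to
  the \<open>m\<close>-th moment. The factor \<open>n ^ m\<close> of this threshold divides every
  factor of the product by \<open>n\<close>.\<close>

lemma card_many_inverted_le:
  fixes \<iota> :: "nat \<Rightarrow> 'f::{field,finite}" and \<delta> :: real
  assumes "CARD('f) = n" "bij_betw \<iota> (idx n) (UNIV :: 'f set)"
    and "nonadaptive_inverter n s q Pre Qry Dec" "affine_decoder n s d \<iota> Qry Dec"
    and "a \<in> bitstrings s" and \<delta>: "0 < \<delta>"
  shows "real (card {f \<in> funcs n. \<delta> * real n \<le> real (card (inverted n Qry Dec a f))}) / real (n ^ n)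
    \<le> inverse \<delta> ^ m * (\<Prod>j=1..m. (real d + 1) * real j / real n + real q / real n)"
    (is "real (card ?S) / _ \<le> _")
proof -
  have n: "0 < n" using assms(1) by (metis zero_less_card_finite)
  have fin: "finite (funcs n)" by (simp add: funcs_def finite_PiE)
  have "real (card ?S) * (\<delta> * n) ^ m = (\<Sum>f\<in>?S. (\<delta> * n) ^ m)" by simp
  also have "\<dots> \<le> (\<Sum>f\<in>?S. real (card (inverted n Qry Dec a f)) ^ m)"
    using \<delta> by (intro sum_mono power_mono) auto
  also have "\<dots> \<le> (\<Sum>f\<in>funcs n. real (card (inverted n Qry Dec a f)) ^ m)"
    using fin by (intro sum_mono2) auto
  also have "\<dots> = real (\<Sum>f\<in>funcs n. card (inverted n Qry Dec a f) ^ m)" by simp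
  also have "\<dots> \<le> real (n ^ n * (\<Prod>j=1..m. (d + 1) * j + q))"
    by (rule of_nat_mono[OF sum_inverted_power_le[OF assms(1-5)]])
  also have "\<dots> = real (n ^ n) * (\<Prod>j=1..m. (real d + 1) * real j + real q)"
    by (simp add: algebra_simps)
  also have "\<dots> = real (n ^ n) * (real n ^ m * (\<Prod>j=1..m. (real d + 1) * real j / real n + real q / real n))"
    using n by (simp add: prod_dividef flip: add_divide_distrib)
  finally show ?thesis
    using n \<delta> by (simp add: field_simps power_mult_distrib)
qed

theorem theorem5p10:
  fixes n s q d m :: nat
    and \<iota> :: "nat \<Rightarrow> 'f::{field,finite}"
    and Pre :: pre and Qry :: qry and Dec :: dec
    and \<tau> \<delta> :: real
  assumes "CARD('f) = n"
    and "bij_betw \<iota> (idx n) (UNIV :: 'f set)"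
    and "nonadaptive_inverter n s q Pre Qry Dec"
    and "real q \<le> real n / 16"
    and "affine_decoder n s d \<iota> Qry Dec"
    and "0 \<le> \<tau>" "\<tau> \<le> 1"
    and "0 \<le> \<delta>" "\<delta> \<le> 1"
    and "real m \<le> real n * log 2 (real n / real q) / (4 * (real d + 1) * log 2 (real n))"
  shows "ereal (measure_pmf.prob (pmf_of_set (funcs n)) {f. success_prob n Pre Qry Dec f \<ge> \<tau>})
    \<le> ereal (alpha n \<tau> \<delta>) + 2 ^ s * inverse (ereal \<delta>) ^ m *
        ereal (\<Prod>j=1..m. (real d + 1) * real j / real n
          + max (root 4 (real q / real n))
                (2 * (real d + 1) * real j * log 2 (real n) / (real n * log 2 (real n / real q))))"
    (is "ereal ?L \<le> _ + _ * _ * ereal (\<Prod>j=1..m. ?t j)")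
proof (cases "\<delta> = 0 \<and> 0 < m")
  case True
  have n: "0 < n" using assms(1) by (metis zero_less_card_finite)
  \<comment> \<open>In \<open>ereal\<close>, \<open>0 * \<infinity>\<close> is \<open>0\<close>, so
    an infinite right side needs a strictly positive product. Each factor is positive through
    \<open>(d + 1) * j / n\<close> with \<open>j \<ge> 1\<close>.\<close>
  have "0 < (\<Prod>j=1..m. ?t j)"
    using n by (intro prod_pos) (auto intro!: add_pos_nonneg simp: le_max_iff_disj)
  moreover have "2 ^ s * inverse (ereal \<delta>) ^ m * ereal P = \<infinity>" if "0 < P" for P
    using True that by simp
  ultimately have "2 ^ s * inverse (ereal \<delta>) ^ m * ereal (\<Prod>j=1..m. ?t j) = \<infinity>"
    by blast
  then show ?thesis by (simp only: plus_ereal.simps ereal_less_eq)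
next
  case False
  have n: "0 < n" using assms(1) by (metis zero_less_card_finite)
  define F where "F = funcs n"
  have fin: "finite F" and cardF: "card F = n ^ n" and ne: "F \<noteq> {}"
    using n by (auto simp: F_def funcs_def finite_PiE card_PiE PiE_eq_empty_iff)
  define S where "S a = {f \<in> F. \<delta> * real n \<le> real (card (inverted n Qry Dec a f))}" for a
  define E\<alpha> :: "(nat \<Rightarrow> nat) set" where
    "E\<alpha> = {f. \<exists>X \<subseteq> idx n. real (card X) \<ge> \<tau> * real n \<and> real (card (f ` X)) \<le> \<delta> * real n}"
  define E where "E = {f. success_prob n Pre Qry Dec f \<ge> \<tau>}"
  have cardB: "finite (bitstrings s)" "card (bitstrings s) = 2 ^ s"
    using finite_lists_length_eq[of "UNIV :: bool set" s] card_lists_length_eq[of "UNIV :: bool set" s]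
    by (simp_all add: bitstrings_def)
  \<comment> \<open>At least \<open>\<tau> n\<close> inputs are inverted successfully. Their image
    is either small, which is the event of \<open>alpha\<close>, or supplies more than
    \<open>\<delta> n\<close> points inverted with advice \<open>Pre f\<close>.\<close>
  have cover: "F \<inter> E \<subseteq> (F \<inter> E\<alpha>) \<union> (\<Union>a\<in>bitstrings s. S a)"
  proof
    fix f assume f: "f \<in> F \<inter> E"
    define X where "X = {x \<in> idx n. Inv Pre Qry Dec (f x) f \<in> fiber n f (f x)}"
    have "idx n \<inter> {x. let y = f x in Inv Pre Qry Dec y f \<in> fiber n f y} = X"
      by (auto simp: X_def Let_def)
    then have "success_prob n Pre Qry Dec f = card X / n"
      using n by (simp add: success_prob_def measure_pmf_of_set)
    moreover have "\<tau> \<le> success_prob n Pre Qry Dec f" using f by (simp add: E_def)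
    ultimately have cardX: "\<tau> * n \<le> card X"
      using n by (simp add: pos_le_divide_eq)
    have "f ` X \<subseteq> inverted n Qry Dec (Pre f) f"
      using f by (auto simp: X_def fiber_def inverted_def Inv_def Let_def F_def funcs_def)
    then have le: "card (f ` X) \<le> card (inverted n Qry Dec (Pre f) f)"
      by (rule card_mono[rotated]) (simp add: inverted_def)
    have "Pre f \<in> bitstrings s"
      using assms(3) f by (auto simp: nonadaptive_inverter_def F_def)
    moreover have "f \<in> E\<alpha> \<or> f \<in> S (Pre f)"
    proof (cases "real (card (f ` X)) \<le> \<delta> * n")
      case True
      moreover have "X \<subseteq> idx n" by (auto simp: X_def)
      ultimately show ?thesis using cardX unfolding E\<alpha>_def by blast
    next
      case False
      then show ?thesis using f le by (simp add: S_def)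
    qed
    ultimately show "f \<in> (F \<inter> E\<alpha>) \<union> (\<Union>a\<in>bitstrings s. S a)" using f by blast
  qed
  have L: "?L = card (F \<inter> E) / n ^ n" and \<alpha>: "alpha n \<tau> \<delta> = card (F \<inter> E\<alpha>) / n ^ n"
    using fin ne cardF unfolding alpha_def E_def E\<alpha>_def F_def by (simp_all add: measure_pmf_of_set)
  have "real (card (S a)) / n ^ n \<le> inverse \<delta> ^ m * (\<Prod>j=1..m. ?t j)" if a: "a \<in> bitstrings s" for a
  \<comment> \<open>For \<open>m = 0\<close> the right side is \<open>1\<close> and
    \<open>\<delta>\<close> may be \<open>0\<close>, which Markov's inequality does not
    cover.\<close>
  proof (cases "m = 0")
    case True
    have "card (S a) \<le> n ^ n" unfolding cardF[symmetric] S_def by (rule card_mono[OF fin]) auto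
    then have "real (card (S a)) \<le> n ^ n" by (metis of_nat_mono of_nat_power)
    then show ?thesis using True n by simp
  next
    case False
    then have \<delta>: "0 < \<delta>" using \<open>\<not> (\<delta> = 0 \<and> 0 < m)\<close> assms(8) by simp
    \<comment> \<open>The assumption on \<open>q\<close> gives \<open>q / n \<le> 1\<close>, and a
      number in \<open>[0, 1]\<close> is at most its fourth root.\<close>
    have root: "real q / n \<le> root 4 (real q / n)"
    proof -
      define r where "r = root 4 (real q / n)"
      have r: "0 \<le> r" "r ^ 4 = real q / n"
        by (simp_all add: r_def)
      have "r \<le> 1" using assms(4) n by (simp add: r_def field_simps)
      then have "r ^ 4 \<le> r" using r(1) power_decreasing[of 1 4 r] by simp
      then show ?thesis using r by (simp add: r_def)
    qed
    have "real (card (S a)) / n ^ n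
        \<le> inverse \<delta> ^ m * (\<Prod>j=1..m. (real d + 1) * real j / real n + real q / real n)"
      using card_many_inverted_le[OF assms(1-3,5) a \<delta>, of m] by (simp add: S_def F_def)
    also have "\<dots> \<le> inverse \<delta> ^ m * (\<Prod>j=1..m. ?t j)"
      using \<delta> root by (intro mult_left_mono prod_mono) (auto simp: le_max_iff_disj)
    finally show ?thesis .
  qed
  then have "(\<Sum>a\<in>bitstrings s. real (card (S a)) / n ^ n)
      \<le> 2 ^ s * (inverse \<delta> ^ m * (\<Prod>j=1..m. ?t j))"
    using sum_bounded_above[of "bitstrings s" "\<lambda>a. real (card (S a)) / n ^ n"] cardB by simp
  moreover have "card (F \<inter> E) \<le> card (F \<inter> E\<alpha>) + (\<Sum>a\<in>bitstrings s. card (S a))"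
  proof -
    have "finite ((F \<inter> E\<alpha>) \<union> (\<Union>a\<in>bitstrings s. S a))"
      using fin cardB by (auto simp: S_def)
    then have "card (F \<inter> E) \<le> card ((F \<inter> E\<alpha>) \<union> (\<Union>a\<in>bitstrings s. S a))"
      using cover by (rule card_mono)
    also have "\<dots> \<le> card (F \<inter> E\<alpha>) + card (\<Union>a\<in>bitstrings s. S a)"
      by (rule card_Un_le)
    finally show ?thesis using card_UN_le[OF cardB(1), of S] by linarith
  qed
  then have "real (card (F \<inter> E)) \<le> real (card (F \<inter> E\<alpha>) + (\<Sum>a\<in>bitstrings s. card (S a)))"
    by (rule of_nat_mono)
  then have "?L \<le> alpha n \<tau> \<delta> + (\<Sum>a\<in>bitstrings s. real (card (S a)) / n ^ n)"
    unfolding L \<alpha> using n by (simp add: divide_right_mono flip: add_divide_distrib sum_divide_distrib)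
  ultimately have main: "?L \<le> alpha n \<tau> \<delta> + 2 ^ s * inverse \<delta> ^ m * (\<Prod>j=1..m. ?t j)"
    by (simp add: mult.assoc)
  have two: "(2 :: ereal) ^ s = ereal (2 ^ s)"
    by (metis ereal_power numeral_eq_ereal)
  \<comment> \<open>Either \<open>m = 0\<close> and both sides are \<open>1\<close>, or
    \<open>\<delta> \<noteq> 0\<close> and the inverse is real.\<close>
  have "inverse (ereal \<delta>) ^ m = ereal (inverse \<delta> ^ m)"
    using False by (cases "m = 0") (simp_all add: one_ereal_def)
  then show ?thesis
    using main by (simp only: two times_ereal.simps plus_ereal.simps ereal_less_eq)
qed

end
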